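(* Let $s>0$ and let $\Gamma\subset\mathbb{R}^2$ be a Lipschitz curve of positive length. Then, given $\epsilon>0$, there exist a finite point set $X:=\{x_i\}_{i=1}^N\subset\mathbb{R}^2$ and a Lipschitz curve $\Gamma_*$ that contains $X$ such that $$B(X,s)\supset B(\Gamma,s)\quad\text{and}\quad \mathcal{H}^1(\Gamma)\le\mathcal{H}^1(\Gamma_* )\le\mathcal{H}^1(\Gamma)+\epsilon.$$
   Context: $\mathcal{H}^1$ denotes one-dimensional Hausdorff measure. For $A\subset\mathbb{R}^2$ and $r>0$, $B(A,r):=\{x\in\mathbb{R}^2:\mathrm{dist}(x,A)\le r\}$ is the closed $r$-neighborhood of $A$, where $\mathrm{dist}(x,A)=\inf\{|x-y|:y\in A\}$ and $|\cdot|$ is the Euclidean norm. A subset $\Gamma\subset\mathbb{R}^2$ is a Lipschitz curve if it is the image of some Lipschitz function $\gamma:[a,b]\to\mathbb{R}^2$ with $-\infty<a<b<+\infty$ (injectivity is not required). The length of $\gamma$ is $\mathrm{length}(\gamma):=\sup\sum_{i=1}^m|\gamma(t_i)-\gamma(t_{i-1})|$, the supremum being over all dissections $a=t_0\le t_1\le\dots\le t_m=b$ of $[a,b]$. The curve $\Gamma$ has positive length when a parameterization $\gamma$ of it has $\mathrm{length}(\gamma)>0$ (equivalently, $\Gamma$ is not a single point). *)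

theory Defs
  imports "HOL-Analysis.Analysis"
begin

(* The sets of a cover are required to be bounded because the library's diameter is
   real-valued and unspecified on unbounded sets.  Finite covers are included, since
   U n may be empty. *)
definition hausdorff1_premeasure :: "real \<Rightarrow> 'a::metric_space set \<Rightarrow> ennreal" where
  "hausdorff1_premeasure \<delta> A =
     Inf {(\<Sum>n. ennreal (diameter (U n))) | U :: nat \<Rightarrow> 'a set.
            A \<subseteq> (\<Union>n. U n) \<and> (\<forall>n. bounded (U n) \<and> diameter (U n) \<le> \<delta>)}"

(* One-dimensional Hausdorff (outer) measure, normalised so that it agrees with
   length on line segments. *)
definition hausdorff1 :: "'a::metric_space set \<Rightarrow> ennreal" where
  "hausdorff1 A = (SUP \<delta>\<in>{0<..}. hausdorff1_premeasure \<delta> A)"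

(* The library sets infdist x {} = 0, whereas dist(x, {}) = inf {} is infinite; with the
   first conjunct the neighbourhood of the empty set is empty. *)
definition closed_nbhd :: "'a::metric_space set \<Rightarrow> real \<Rightarrow> 'a set" where
  "closed_nbhd A r = {x. A \<noteq> {} \<and> infdist x A \<le> r}"

definition lipschitz_parameterization ::
    "real \<Rightarrow> real \<Rightarrow> (real \<Rightarrow> 'a::metric_space) \<Rightarrow> 'a set \<Rightarrow> bool" where
  "lipschitz_parameterization a b \<gamma> \<Gamma> \<longleftrightarrow>
     a < b \<and> (\<exists>C. C-lipschitz_on {a..b} \<gamma>) \<and> \<Gamma> = \<gamma> ` {a..b}"

definition lipschitz_curve :: "'a::metric_space set \<Rightarrow> bool" where
  "lipschitz_curve \<Gamma> \<longleftrightarrow> (\<exists>a b \<gamma>. lipschitz_parameterization a b \<gamma> \<Gamma>)"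

definition curve_length ::
    "real \<Rightarrow> real \<Rightarrow> (real \<Rightarrow> 'a::real_normed_vector) \<Rightarrow> ennreal" where
  "curve_length a b \<gamma> =
     Sup {(\<Sum>i=1..m. ennreal (norm (\<gamma> (t i) - \<gamma> (t (i - 1))))) | (m :: nat) (t :: nat \<Rightarrow> real).
            t 0 = a \<and> t m = b \<and> (\<forall>i\<in>{1..m}. t (i - 1) \<le> t i)}"

definition has_positive_length :: "'a::real_normed_vector set \<Rightarrow> bool" where
  "has_positive_length \<Gamma> \<longleftrightarrow>
     (\<exists>a b \<gamma>. lipschitz_parameterization a b \<gamma> \<Gamma> \<and> 0 < curve_length a b \<gamma>)"

end

theory Submission
  imports Defs
begin

text \<open>
  By compactness, a finite \<open>X \<subseteq> \<Gamma>'\<close> exists as soon as every point of the closed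
  \<open>s\<close>-neighbourhood of \<open>\<Gamma>\<close> has distance strictly less than \<open>s\<close> from \<open>\<Gamma>'\<close>. The points that
  matter are those \<open>z\<close> at distance exactly \<open>s\<close> from \<open>\<Gamma>\<close>. If such a \<open>z\<close> is attained at \<open>\<gamma> u\<close>
  with \<open>u\<close> near \<open>t\<close>, then \<open>\<bar>z - \<gamma> t\<bar>\<^sup>2 \<le> s\<^sup>2 + o(\<bar>u - t\<bar>)\<close>: such \<open>z\<close> accumulate only at centres \<open>l\<close>
  of balls touching \<open>\<Gamma>\<close> at \<open>\<gamma> t\<close>, and \<open>\<gamma> u\<close> lies outside the ball around \<open>l\<close>. Hence a small
  cross of segments at \<open>\<gamma> t\<close>, of size \<open>\<theta>\<close> times the length of a short parameter interval around
  \<open>t\<close>, comes strictly within \<open>s\<close> of all \<open>z\<close> attained on that interval. The crosses belonging to a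
  suitable partition of the parameter interval have total length proportional to \<open>\<theta>\<close>, and
  attaching them to \<open>\<Gamma>\<close> gives \<open>\<Gamma>'\<close>.
\<close>

section \<open>Hausdorff measure\<close>

lemma hausdorff1_premeasure_le:
  assumes "A \<subseteq> (\<Union>n. U n)" "\<And>n. bounded (U n)" "\<And>n. diameter (U n) \<le> \<delta>"
  shows "hausdorff1_premeasure \<delta> A \<le> (\<Sum>n. ennreal (diameter (U n)))"
  unfolding hausdorff1_premeasure_def by (rule Inf_lower) (use assms in blast)

lemma hausdorff1_premeasure_mono:
  assumes "A \<subseteq> B"
  shows "hausdorff1_premeasure \<delta> A \<le> hausdorff1_premeasure \<delta> B"
  unfolding hausdorff1_premeasure_def by (rule Inf_superset_mono) (use assms in blast)

lemma hausdorff1_mono: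
  assumes "A \<subseteq> B"
  shows "hausdorff1 A \<le> hausdorff1 B"
  unfolding hausdorff1_def by (intro SUP_mono') (rule hausdorff1_premeasure_mono[OF assms])

text \<open>Covers of \<open>A\<close> and \<open>B\<close> interleave into one cover of the union
  at the same scale \<delta>. Covers within \<open>e / 2\<close> of each infimum then give the bound
  up to \<open>e\<close>.\<close>

lemma hausdorff1_premeasure_Un_le:
  "hausdorff1_premeasure \<delta> (A \<union> B) \<le> hausdorff1_premeasure \<delta> A + hausdorff1_premeasure \<delta> B"
proof -
  have *: "hausdorff1_premeasure \<delta> (A \<union> B) \<le>
           (\<Sum>n. ennreal (diameter (U n))) + (\<Sum>n. ennreal (diameter (V n)))"
    if U: "A \<subseteq> (\<Union>n. U n)" "\<forall>n. bounded (U n) \<and> diameter (U n) \<le> \<delta>"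
      and V: "B \<subseteq> (\<Union>n. V n)" "\<forall>n. bounded (V n) \<and> diameter (V n) \<le> \<delta>" for U V
  proof -
    \<comment> \<open>The even indices carry \<open>U\<close> and the odd ones \<open>V\<close>, so
      grouping the series of \<open>W\<close> in consecutive pairs splits it into the two
      series.\<close>
    define W where "W n = (if even n then U (n div 2) else V (n div 2))" for n :: nat
    have We: "W (2 * n) = U n" and Wo: "W (Suc (2 * n)) = V n" for n
      by (auto simp: W_def)
    have "hausdorff1_premeasure \<delta> (A \<union> B) \<le> (\<Sum>n. ennreal (diameter (W n)))"
    proof (rule hausdorff1_premeasure_le)
      have "U n \<subseteq> (\<Union>n. W n)" "V n \<subseteq> (\<Union>n. W n)" for n
        using UN_upper[of "2 * n" UNIV W] UN_upper[of "Suc (2 * n)" UNIV W] by (simp_all add: We Wo)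
      then have "(\<Union>n. U n) \<subseteq> (\<Union>n. W n)" and "(\<Union>n. V n) \<subseteq> (\<Union>n. W n)"
        by (simp_all only: UN_subset_iff ball_simps simp_thms)
      then show "A \<union> B \<subseteq> (\<Union>n. W n)"
        using U(1) V(1) by (meson Un_least order_trans)
    qed (simp_all add: W_def U(2) V(2))
    also have "\<dots> = (\<Sum>n. ennreal (diameter (W (2 * n))) + ennreal (diameter (W (Suc (2 * n)))))"
    proof -
      have "(\<lambda>n. \<Sum>i\<in>{n * 2..<n * 2 + 2}. ennreal (diameter (W i))) sums
            (\<Sum>n. ennreal (diameter (W n)))"
        by (rule sums_group) (auto simp: summable_sums)
      moreover have "(\<Sum>i\<in>{n * 2..<n * 2 + 2}. ennreal (diameter (W i))) =
          ennreal (diameter (W (2 * n))) + ennreal (diameter (W (Suc (2 * n))))" for n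
        by (simp add: mult.commute)
      ultimately show ?thesis by (simp add: sums_iff)
    qed
    also have "\<dots> = (\<Sum>n. ennreal (diameter (U n))) + (\<Sum>n. ennreal (diameter (V n)))"
      unfolding We Wo by (rule suminf_add[symmetric]) auto
    finally show ?thesis .
  qed
  show ?thesis
  \<comment> \<open>This rule lets the right-hand side be taken finite. Both premeasures are then
    finite, so adding \<open>e / 2\<close> strictly increases them and some cover lies below the
    increased value.\<close>
  proof (rule ennreal_le_epsilon)
    fix e :: real assume "0 < e"
    assume fin: "hausdorff1_premeasure \<delta> A + hausdorff1_premeasure \<delta> B < top"
    have ex: "\<exists>U :: nat \<Rightarrow> 'a set. S \<subseteq> (\<Union>n. U n) \<and> (\<forall>n. bounded (U n) \<and> diameter (U n) \<le> \<delta>) \<and>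
        (\<Sum>n. ennreal (diameter (U n))) < hausdorff1_premeasure \<delta> S + ennreal (e / 2)"
      if "hausdorff1_premeasure \<delta> S < top" for S
    proof -
      have "hausdorff1_premeasure \<delta> S < hausdorff1_premeasure \<delta> S + ennreal (e / 2)"
        using that \<open>0 < e\<close> by (simp add: ennreal_zero_less_divide less_top)
      then show ?thesis
        by (subst (asm) (1) hausdorff1_premeasure_def, unfold Inf_less_iff) blast
    qed
    have "hausdorff1_premeasure \<delta> A < top" "hausdorff1_premeasure \<delta> B < top"
      using fin by auto
    from this[THEN ex] obtain U V :: "nat \<Rightarrow> 'a set" where
      U: "A \<subseteq> (\<Union>n. U n)" "\<forall>n. bounded (U n) \<and> diameter (U n) \<le> \<delta>"
        "(\<Sum>n. ennreal (diameter (U n))) < hausdorff1_premeasure \<delta> A + ennreal (e / 2)" and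
      V: "B \<subseteq> (\<Union>n. V n)" "\<forall>n. bounded (V n) \<and> diameter (V n) \<le> \<delta>"
        "(\<Sum>n. ennreal (diameter (V n))) < hausdorff1_premeasure \<delta> B + ennreal (e / 2)"
      by blast
    have "hausdorff1_premeasure \<delta> (A \<union> B) \<le>
        (hausdorff1_premeasure \<delta> A + ennreal (e / 2)) + (hausdorff1_premeasure \<delta> B + ennreal (e / 2))"
      using *[OF U(1,2) V(1,2)] add_mono[OF less_imp_le[OF U(3)] less_imp_le[OF V(3)]]
      by (rule order_trans)
    also have "\<dots> = hausdorff1_premeasure \<delta> A + hausdorff1_premeasure \<delta> B +
        (ennreal (e / 2) + ennreal (e / 2))"
      by (simp only: ac_simps)
    also have "ennreal (e / 2) + ennreal (e / 2) = ennreal e"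
      using \<open>0 < e\<close> by (subst ennreal_plus[symmetric]) auto
    finally show "hausdorff1_premeasure \<delta> (A \<union> B) \<le>
        hausdorff1_premeasure \<delta> A + hausdorff1_premeasure \<delta> B + ennreal e" .
  qed
qed

lemma hausdorff1_Un_le: "hausdorff1 (A \<union> B) \<le> hausdorff1 A + hausdorff1 B"
proof -
  have "hausdorff1_premeasure \<delta> (A \<union> B) \<le> hausdorff1 A + hausdorff1 B" if "\<delta> > 0" for \<delta>
    using that
    by (intro order_trans[OF hausdorff1_premeasure_Un_le] add_mono)
       (auto simp: hausdorff1_def intro!: SUP_upper)
  then show ?thesis
    unfolding hausdorff1_def[of "A \<union> B"] by (intro SUP_least) auto
qed

text \<open>At each scale \<delta> the segment is cut into \<open>n\<close> equal pieces of diameter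
  at most \<open>dist p q / n\<close>, whose total is at most \<open>dist p q\<close> whatever
  \<delta> is.\<close>

lemma hausdorff1_closed_segment_le:
  fixes p q :: "'a::euclidean_space"
  shows "hausdorff1 (closed_segment p q) \<le> ennreal (dist p q)"
  unfolding hausdorff1_def
proof (rule SUP_least)
  fix \<delta> :: real assume "\<delta> \<in> {0<..}"
  then have "\<delta> > 0" by simp
  obtain N :: nat where "dist p q / \<delta> < real N" using reals_Archimedean2 by blast
  define n where "n = Suc N"
  have n: "n > 0" "dist p q / n \<le> \<delta>"
  proof -
    have "dist p q \<le> real N * \<delta>"
      using \<open>dist p q / \<delta> < real N\<close> \<open>\<delta> > 0\<close> by (simp add: field_simps)
    also have "\<dots> \<le> real n * \<delta>" using \<open>\<delta> > 0\<close> by (simp add: n_def)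
    finally show "dist p q / n \<le> \<delta>" by (simp add: n_def field_simps)
  qed (simp add: n_def)
  define x where "x u = p + u *\<^sub>R (q - p)" for u :: real
  have dx: "dist (x u) (x v) = \<bar>u - v\<bar> * dist p q" for u v
  proof -
    have "x u - x v = (u - v) *\<^sub>R (q - p)" by (simp add: x_def algebra_simps)
    then show ?thesis by (simp add: dist_norm norm_minus_commute)
  qed
  \<comment> \<open>Beyond index \<open>n\<close> the sets are empty and have diameter 0, so the
    series is a finite sum.\<close>
  define U where "U i = (if i < n then x ` {i / n..Suc i / n} else {})" for i
  have diam: "diameter (U i) \<le> dist p q / n" for i
  proof (rule diameter_le)
    fix v w assume "v \<in> U i" "w \<in> U i"
    then obtain v' w' where *: "v = x v'" "w = x w'" "v' \<in> {i / n..Suc i / n}" "w' \<in> {i / n..Suc i / n}"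
      by (auto simp: U_def split: if_splits)
    have "\<bar>v' - w'\<bar> \<le> Suc i / n - i / n" using * by auto
    also have "\<dots> = 1 / n" by (subst diff_divide_distrib[symmetric]) simp
    finally have "\<bar>v' - w'\<bar> * dist p q \<le> 1 / n * dist p q" by (rule mult_right_mono) simp
    then show "norm (v - w) \<le> dist p q / n" using * dx[of v' w'] by (simp add: dist_norm)
  qed simp
  have "hausdorff1_premeasure \<delta> (closed_segment p q) \<le> (\<Sum>i. ennreal (diameter (U i)))"
  proof (rule hausdorff1_premeasure_le)
    show "closed_segment p q \<subseteq> (\<Union>i. U i)"
    proof
      fix y assume "y \<in> closed_segment p q"
      then obtain u where u: "0 \<le> u" "u \<le> 1" "y = x u"
        by (auto simp: in_segment x_def algebra_simps)
      \<comment> \<open>The minimum matters only at the endpoint \<open>u = 1\<close>, where the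
        floor is \<open>n\<close> but the last piece has index \<open>n - 1\<close>.\<close>
      define i where "i = min (nat \<lfloor>u * n\<rfloor>) (n - 1)"
      have "0 \<le> u * n" "u * n \<le> n" using u n by (auto simp: mult_left_le_one_le)
      have "i < n" using n by (auto simp: i_def)
      moreover have "real i \<le> u * n" using \<open>0 \<le> u * n\<close> unfolding i_def by linarith
      moreover have "u * n \<le> real (Suc i)"
      proof (cases "nat \<lfloor>u * n\<rfloor> \<le> n - 1")
        case True
        then show ?thesis using \<open>0 \<le> u * n\<close> unfolding i_def by linarith
      next
        case False
        then have "Suc i = n" using n by (simp add: i_def)
        then show ?thesis using \<open>u * n \<le> n\<close> by simp
      qed
      ultimately have "y \<in> U i" using u n by (auto simp: U_def field_simps)
      then show "y \<in> (\<Union>i. U i)" by blast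
    qed
    show "bounded (U i)" for i
      unfolding U_def x_def
      by (auto intro!: compact_imp_bounded compact_continuous_image continuous_intros)
    show "diameter (U i) \<le> \<delta>" for i using diam n(2) by (rule order_trans)
  qed
  also have "\<dots> = (\<Sum>i<n. ennreal (diameter (U i)))"
    by (rule suminf_finite) (auto simp: U_def)
  also have "\<dots> \<le> (\<Sum>i<n. ennreal (dist p q / n))"
    by (intro sum_mono ennreal_leI diam)
  also have "\<dots> = ennreal (\<Sum>i<n. dist p q / n)"
    by (rule sum_ennreal) simp
  also have "(\<Sum>i<n. dist p q / n) = dist p q" using n by simp
  finally show "hausdorff1_premeasure \<delta> (closed_segment p q) \<le> ennreal (dist p q)" .
qed

section \<open>Attaching segments to a curve\<close>

text \<open>The new curve runs along \<open>\<gamma>\<close> up to time \<open>u\<close>, out and back along the segment during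
  \<open>[u, u + 2]\<close>, and then along the rest of \<open>\<gamma>\<close>.\<close>

lemma lipschitz_curve_Un_closed_segment:
  fixes \<Gamma> :: "'a::real_normed_vector set"
  assumes "lipschitz_curve \<Gamma>" "p \<in> \<Gamma>"
  shows "lipschitz_curve (\<Gamma> \<union> closed_segment p q)"
proof -
  obtain a b C and \<gamma> :: "real \<Rightarrow> 'a" where ab: "a < b" and lip: "C-lipschitz_on {a..b} \<gamma>" and \<Gamma>: "\<Gamma> = \<gamma> ` {a..b}"
    using assms(1) unfolding lipschitz_curve_def lipschitz_parameterization_def by metis
  obtain u where u: "a \<le> u" "u \<le> b" "p = \<gamma> u" using assms(2) \<Gamma> by auto
  \<comment> \<open>\<open>c\<close> is the delayed clock: it equals \<open>t\<close> up to
    \<open>u\<close>, rests at \<open>u\<close> on \<open>[u, u + 2]\<close> and then lags by 2.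
    \<open>h\<close> is the tent of height 1 supported on \<open>[u, u + 2]\<close>, which drives
    the trip out and back. Both are 1-Lipschitz, hence \<open>f\<close> is Lipschitz.\<close>
  define c where "c t = min t (max u (t - 2))" for t
  define h where "h t = max 0 (1 - \<bar>t - u - 1\<bar>)" for t
  define f where "f t = \<gamma> (c t) + h t *\<^sub>R (q - p)" for t
  have c_lip: "1-lipschitz_on {a..b + 2} c"
    by (rule lipschitz_onI) (auto simp: c_def dist_real_def)
  have h_lip: "1-lipschitz_on {a..b + 2} h"
    by (rule lipschitz_onI) (auto simp: h_def dist_real_def)
  have c_im: "c ` {a..b + 2} \<subseteq> {a..b}" using u by (auto simp: c_def)
  have "\<exists>C. C-lipschitz_on {a..b + 2} f"
  proof -
    have "(C * 1)-lipschitz_on {a..b + 2} (\<lambda>t. \<gamma> (c t))"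
      using lipschitz_on_compose2[OF c_lip lipschitz_on_subset[OF lip c_im]] .
    moreover have "(norm (q - p))-lipschitz_on {a..b + 2} (\<lambda>t. h t *\<^sub>R (q - p))"
    proof (rule lipschitz_onI)
      fix s t assume "s \<in> {a..b + 2}" "t \<in> {a..b + 2}"
      then have "\<bar>h s - h t\<bar> \<le> dist s t"
        using lipschitz_onD[OF h_lip, of s t] by (simp add: dist_real_def)
      then have "\<bar>h s - h t\<bar> * norm (q - p) \<le> dist s t * norm (q - p)"
        by (rule mult_right_mono) simp
      then show "dist (h s *\<^sub>R (q - p)) (h t *\<^sub>R (q - p)) \<le> norm (q - p) * dist s t"
        by (simp add: dist_norm scaleR_left_diff_distrib[symmetric] mult.commute)
    qed simp
    ultimately show ?thesis unfolding f_def using lipschitz_on_add by blast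
  qed
  moreover have "f ` {a..b + 2} = \<Gamma> \<union> closed_segment p q"
  proof (intro equalityI subsetI)
    fix y assume "y \<in> f ` {a..b + 2}"
    then obtain t where t: "a \<le> t" "t \<le> b + 2" "y = f t" by auto
    show "y \<in> \<Gamma> \<union> closed_segment p q"
    proof (cases "u \<le> t \<and> t \<le> u + 2")
      case True
      then have "c t = u" by (auto simp: c_def)
      then have "y = (1 - h t) *\<^sub>R p + h t *\<^sub>R q" "0 \<le> h t" "h t \<le> 1"
        using t u by (auto simp: f_def h_def algebra_simps)
      then show ?thesis by (auto simp: in_segment)
    next
      case False
      then have "h t = 0" by (auto simp: h_def)
      then have "y = \<gamma> (c t)" using t by (simp add: f_def)
      moreover have "c t \<in> {a..b}" using c_im t unfolding image_subset_iff by simp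
      ultimately show ?thesis using \<Gamma> by blast
    qed
  next
    fix y assume "y \<in> \<Gamma> \<union> closed_segment p q"
    then consider t where "a \<le> t" "t \<le> b" "y = \<gamma> t"
      | w where "0 \<le> w" "w \<le> 1" "y = (1 - w) *\<^sub>R p + w *\<^sub>R q"
      by (auto simp: \<Gamma> in_segment)
    then show "y \<in> f ` {a..b + 2}"
    proof cases
      case 1
      define t' where "t' = (if t \<le> u then t else t + 2)"
      have "c t' = t" "h t' = 0" "t' \<in> {a..b + 2}"
        using 1 by (auto simp: t'_def c_def h_def)
      then have "f t' = y" using 1 by (simp add: f_def)
      then show ?thesis using \<open>t' \<in> {a..b + 2}\<close> by blast
    next
      case 2
      have "c (u + w) = u" "h (u + w) = w" "u + w \<in> {a..b + 2}"
        using 2 u by (auto simp: c_def h_def)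
      then have "f (u + w) = y" using 2 u by (simp add: f_def algebra_simps)
      then show ?thesis using \<open>u + w \<in> {a..b + 2}\<close> by blast
    qed
  qed
  ultimately show ?thesis
    using ab unfolding lipschitz_curve_def lipschitz_parameterization_def
    by (intro exI[of _ a] exI[of _ "b + 2"] exI[of _ f]) auto
qed

text \<open>The points of \<open>Y\<close> are joined to \<open>p\<close> by segments one at a time.
  The centre \<open>p\<close> stays on the growing curve, and each segment adds at most \<eta> to
  the measure.\<close>

lemma attach_star:
  fixes \<Gamma> :: "'a::euclidean_space set" and \<eta> :: real
  assumes "finite Y" "lipschitz_curve \<Gamma>" "p \<in> \<Gamma>" "\<And>y. y \<in> Y \<Longrightarrow> dist p y \<le> \<eta>" "0 \<le> \<eta>"
  shows "\<exists>\<Gamma>'. lipschitz_curve \<Gamma>' \<and> \<Gamma> \<union> Y \<subseteq> \<Gamma>' \<and>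
              hausdorff1 \<Gamma>' \<le> hausdorff1 \<Gamma> + ennreal (card Y * \<eta>)"
  using assms(1,4)
proof (induction Y rule: finite_induct)
  case empty
  then show ?case using assms(2) by (intro exI[of _ \<Gamma>]) simp
next
  case (insert y Y)
  then obtain \<Gamma>' where \<Gamma>': "lipschitz_curve \<Gamma>'" "\<Gamma> \<union> Y \<subseteq> \<Gamma>'"
    "hausdorff1 \<Gamma>' \<le> hausdorff1 \<Gamma> + ennreal (card Y * \<eta>)" by auto
  have "hausdorff1 (\<Gamma>' \<union> closed_segment p y) \<le> hausdorff1 \<Gamma>' + hausdorff1 (closed_segment p y)"
    by (rule hausdorff1_Un_le)
  also have "\<dots> \<le> (hausdorff1 \<Gamma> + ennreal (card Y * \<eta>)) + ennreal \<eta>"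
    using \<Gamma>'(3) insert.prems[of y]
    by (intro add_mono order_trans[OF hausdorff1_closed_segment_le] ennreal_leI) auto
  also have "\<dots> = hausdorff1 \<Gamma> + ennreal (card (insert y Y) * \<eta>)"
  proof -
    have "real (card (insert y Y)) * \<eta> = card Y * \<eta> + \<eta>"
      using insert.hyps by (simp add: algebra_simps)
    then show ?thesis using assms(5) by (simp add: ennreal_plus add.assoc)
  qed
  finally have "hausdorff1 (\<Gamma>' \<union> closed_segment p y) \<le>
    hausdorff1 \<Gamma> + ennreal (card (insert y Y) * \<eta>)" .
  moreover have "lipschitz_curve (\<Gamma>' \<union> closed_segment p y)"
    using \<Gamma>' assms(3) by (intro lipschitz_curve_Un_closed_segment) auto
  ultimately show ?case using \<Gamma>'(2) by (intro exI[of _ "\<Gamma>' \<union> closed_segment p y"]) auto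
qed

section \<open>Touching balls\<close>

text \<open>In the alternating sum of the four squared distances all squares cancel, leaving twice
  the inner product of \<open>z - l\<close> and \<open>p' - p\<close>. The error is thus a product
  of two distances, and it is of smaller order than \<open>dist p' p\<close> once \<open>z\<close>
  tends to \<open>l\<close>.\<close>

lemma touching_balls_dist:
  fixes p p' z l :: "'a::real_inner"
  assumes "dist z p' = s" "dist l p = s" "s \<le> dist l p'" "0 \<le> s"
  shows "(dist z p)\<^sup>2 \<le> s\<^sup>2 + 2 * dist z l * dist p' p"
proof -
  have "s\<^sup>2 \<le> (dist l p')\<^sup>2" using assms by (simp add: power_mono)
  then have "(dist z p)\<^sup>2 - s\<^sup>2 \<le> ((dist z p)\<^sup>2 - (dist z p')\<^sup>2) + ((dist l p')\<^sup>2 - (dist l p)\<^sup>2)"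
    using assms by simp
  also have "\<dots> = 2 * ((z - l) \<bullet> (p' - p))"
    by (simp add: dist_norm power2_norm_eq_inner algebra_simps inner_commute)
  also have "\<dots> \<le> 2 * (dist z l * dist p' p)"
    using norm_cauchy_schwarz[of "z - l" "p' - p"] by (simp add: dist_norm)
  finally show ?thesis by simp
qed

text \<open>Otherwise there are counterexamples \<open>u n\<close> tending to \<open>t\<close>, with
  centres \<open>z n\<close> that subconverge to some \<open>l\<close> touching the curve at
  \<open>t\<close>. Comparing \<open>z n\<close> with \<open>l\<close> by
  \<open>touching_balls_dist\<close> bounds \<kappa> by a multiple of \<open>dist (z n) l\<close>,
  which tends to 0 along the subsequence. The radius \<delta> serves all \<open>z\<close> at once
  but may depend on \<open>t\<close>.\<close>

lemma touching_ball_dist_near: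
  fixes \<gamma> :: "real \<Rightarrow> 'a::euclidean_space"
  assumes lip: "C-lipschitz_on S \<gamma>" and "t \<in> S" "0 < s" "0 < \<kappa>"
  shows "\<exists>\<delta>>0. \<forall>u\<in>S. \<forall>z. \<bar>u - t\<bar> < \<delta> \<and> dist z (\<gamma> u) = s \<and> (\<forall>v\<in>S. s \<le> dist z (\<gamma> v)) \<longrightarrow>
           (dist z (\<gamma> t))\<^sup>2 \<le> s\<^sup>2 + \<kappa> * \<bar>u - t\<bar>"
proof (rule ccontr)
  assume neg: "\<not> ?thesis"
  have "\<exists>u z. u \<in> S \<and> \<bar>u - t\<bar> < 1 / Suc n \<and> dist z (\<gamma> u) = s \<and> (\<forall>v\<in>S. s \<le> dist z (\<gamma> v)) \<and>
      s\<^sup>2 + \<kappa> * \<bar>u - t\<bar> < (dist z (\<gamma> t))\<^sup>2" for n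
  proof -
    have "(0::real) < 1 / Suc n" by simp
    with neg show ?thesis unfolding not_le[symmetric] by blast
  qed
  then obtain u z where u: "\<And>n. u n \<in> S" "\<And>n. \<bar>u n - t\<bar> < 1 / Suc n"
    and z: "\<And>n. dist (z n) (\<gamma> (u n)) = s" "\<And>n v. v \<in> S \<Longrightarrow> s \<le> dist (z n) (\<gamma> v)"
    and big: "\<And>n. s\<^sup>2 + \<kappa> * \<bar>u n - t\<bar> < (dist (z n) (\<gamma> t))\<^sup>2"
    by metis
  have C: "0 \<le> C" using lip by (rule lipschitz_on_nonneg)
  have L: "dist (\<gamma> (u n)) (\<gamma> t) \<le> C * \<bar>u n - t\<bar>" for n
    using lipschitz_onD[OF lip u(1) \<open>t \<in> S\<close>] by (simp add: dist_real_def)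
  have "u \<longlonglongrightarrow> t"
  proof (rule metric_tendsto_imp_tendsto[OF LIMSEQ_Suc[OF lim_1_over_n]])
    show "\<forall>\<^sub>F n in sequentially. dist (u n) t \<le> dist (1 / real (Suc n)) 0"
      using u(2) by (intro always_eventually allI) (simp add: dist_real_def less_imp_le)
  qed
  then have "(\<lambda>n. C * \<bar>u n - t\<bar>) \<longlonglongrightarrow> C * \<bar>t - t\<bar>" by (intro tendsto_intros)
  then have "(\<lambda>n. C * \<bar>u n - t\<bar>) \<longlonglongrightarrow> 0" by simp
  then have g: "(\<lambda>n. dist (\<gamma> (u n)) (\<gamma> t)) \<longlonglongrightarrow> 0"
    by (rule Lim_null_comparison[rotated]) (use L in \<open>simp add: always_eventually\<close>)
  then have \<gamma>u: "(\<lambda>n. \<gamma> (u n)) \<longlonglongrightarrow> \<gamma> t" by (rule tendsto_dist_iff[THEN iffD2])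
  \<comment> \<open>The centres stay in one compact ball, which supplies the convergent
    subsequence.\<close>
  have "z n \<in> cball (\<gamma> t) (s + C)" for n
  proof -
    have "\<bar>u n - t\<bar> \<le> 1"
      using u(2)[of n] by (rule order_trans[OF less_imp_le]) simp
    then have "C * \<bar>u n - t\<bar> \<le> C" using C by (simp add: mult_left_le)
    then show ?thesis
      using dist_triangle[of "z n" "\<gamma> t" "\<gamma> (u n)"] L[of n] z(1)[of n]
      by (simp add: dist_commute)
  qed
  then obtain l r where r: "strict_mono r" "(z \<circ> r) \<longlonglongrightarrow> l"
    using compact_cball[of "\<gamma> t" "s + C", unfolded compact_def, rule_format, of z] by blast
  have l_far: "s \<le> dist l (\<gamma> v)" if "v \<in> S" for v
  proof (rule tendsto_lowerbound)
    show "(\<lambda>n. dist ((z \<circ> r) n) (\<gamma> v)) \<longlonglongrightarrow> dist l (\<gamma> v)" by (intro tendsto_intros r)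
  qed (simp_all add: z(2)[OF that])
  have "dist l (\<gamma> t) = s"
  proof (rule LIMSEQ_unique)
    have "(\<lambda>n. \<gamma> (u (r n))) \<longlonglongrightarrow> \<gamma> t"
      using LIMSEQ_subseq_LIMSEQ[OF \<gamma>u r(1)] by (simp add: o_def)
    then show "(\<lambda>n. dist ((z \<circ> r) n) (\<gamma> (u (r n)))) \<longlonglongrightarrow> dist l (\<gamma> t)"
      by (intro tendsto_intros r)
  qed (simp add: z)
  \<comment> \<open>The factor \<open>\<bar>u n - t\<bar>\<close> cancels because the inequality is
    strict, which excludes \<open>u n = t\<close>.\<close>
  have "\<kappa> < 2 * dist (z n) l * C" for n
  proof -
    have "s\<^sup>2 + \<kappa> * \<bar>u n - t\<bar> < s\<^sup>2 + 2 * dist (z n) l * dist (\<gamma> (u n)) (\<gamma> t)"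
      by (rule less_le_trans[OF big touching_balls_dist[OF z(1) \<open>dist l (\<gamma> t) = s\<close> l_far[OF u(1)]]])
        (use \<open>0 < s\<close> in simp)
    also have "\<dots> \<le> s\<^sup>2 + 2 * dist (z n) l * (C * \<bar>u n - t\<bar>)"
      using L[of n] by (intro add_left_mono mult_left_mono) auto
    finally have "\<kappa> * \<bar>u n - t\<bar> < (2 * dist (z n) l * C) * \<bar>u n - t\<bar>" by (simp add: ac_simps)
    then show ?thesis by (rule mult_right_less_imp_less) simp
  qed
  then have "\<forall>\<^sub>F n in sequentially. \<kappa> \<le> 2 * dist ((z \<circ> r) n) l * C"
    by (intro always_eventually allI) (simp add: less_imp_le)
  moreover have "(\<lambda>n. 2 * dist ((z \<circ> r) n) l * C) \<longlonglongrightarrow> 2 * dist l l * C"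
    by (intro tendsto_intros r)
  ultimately have "\<kappa> \<le> 2 * dist l l * C"
    using tendsto_lowerbound trivial_limit_sequentially by blast
  then show False using \<open>0 < \<kappa>\<close> by simp
qed

section \<open>Crosses that enter the touching balls\<close>

text \<open>The largest coordinate is at least the average one, and the sum of the absolute
  coordinates dominates the norm.\<close>

lemma ex_Basis_inner_ge:
  fixes w :: "'a::euclidean_space"
  shows "\<exists>b\<in>Basis. norm w / DIM('a) \<le> \<bar>w \<bullet> b\<bar>"
proof (rule ccontr)
  assume "\<not> ?thesis"
  then have "(\<Sum>b\<in>Basis. \<bar>w \<bullet> b\<bar>) < (\<Sum>b\<in>(Basis :: 'a set). norm w / DIM('a))"
    by (intro sum_strict_mono) (auto simp: not_le)
  then show False using norm_le_l1[of w] by simp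
qed

text \<open>Only the tips of the arms belong to this set; the arms are the segments that
  \<open>attach_star\<close> draws to them.\<close>

definition cross :: "'a::euclidean_space \<Rightarrow> real \<Rightarrow> 'a set" where
  "cross p \<eta> = (\<lambda>b. p + \<eta> *\<^sub>R b) ` Basis \<union> (\<lambda>b. p - \<eta> *\<^sub>R b) ` Basis"

lemma finite_cross: "finite (cross p \<eta>)"
  by (simp add: cross_def)

lemma card_cross_le: "card (cross (p :: 'a::euclidean_space) \<eta>) \<le> 2 * DIM('a)"
proof -
  have "card (cross p \<eta>) \<le>
      card ((\<lambda>b. p + \<eta> *\<^sub>R b) ` Basis) + card ((\<lambda>b. p - \<eta> *\<^sub>R b) ` (Basis :: 'a set))"
    unfolding cross_def by (rule card_Un_le)
  also have "\<dots> \<le> DIM('a) + DIM('a)" by (intro add_mono card_image_le) auto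
  finally show ?thesis by simp
qed

lemma dist_cross: "y \<in> cross p \<eta> \<Longrightarrow> 0 \<le> \<eta> \<Longrightarrow> dist p y = \<eta>"
  by (auto simp: cross_def dist_norm)

text \<open>Moving from \<open>p\<close> along the axis on which \<open>z - p\<close> has a large
  coordinate, in the direction of \<open>z\<close>, gains a term linear in \<eta> and costs only the
  square of \<eta>.\<close>

lemma ex_cross_dist_le:
  fixes z p :: "'a::euclidean_space"
  assumes "0 \<le> \<eta>"
  shows "\<exists>y\<in>cross p \<eta>. (dist z y)\<^sup>2 \<le> (dist z p)\<^sup>2 - 2 * \<eta> * dist z p / DIM('a) + \<eta>\<^sup>2"
proof -
  obtain b :: 'a where b: "b \<in> Basis" "norm (z - p) / DIM('a) \<le> \<bar>(z - p) \<bullet> b\<bar>"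
    using ex_Basis_inner_ge by blast
  \<comment> \<open>The sign selects the arm pointing towards \<open>z\<close>. At a zero coordinate
    it is 1, so that its square is always 1.\<close>
  define \<sigma> :: real where "\<sigma> = (if (z - p) \<bullet> b \<ge> 0 then 1 else -1)"
  have "\<sigma> * ((z - p) \<bullet> b) = \<bar>(z - p) \<bullet> b\<bar>" "\<sigma>\<^sup>2 = 1" by (auto simp: \<sigma>_def)
  have "p + (\<eta> * \<sigma>) *\<^sub>R b \<in> cross p \<eta>" using b by (auto simp: cross_def \<sigma>_def)
  moreover have "(dist z (p + (\<eta> * \<sigma>) *\<^sub>R b))\<^sup>2 =
      (dist z p)\<^sup>2 - 2 * \<eta> * \<bar>(z - p) \<bullet> b\<bar> + \<eta>\<^sup>2"
  proof -
    have "(dist z (p + (\<eta> * \<sigma>) *\<^sub>R b))\<^sup>2 = (norm ((z - p) - (\<eta> * \<sigma>) *\<^sub>R b))\<^sup>2"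
      by (simp add: dist_norm diff_diff_eq)
    also have "\<dots> = (norm (z - p))\<^sup>2 - 2 * \<eta> * (\<sigma> * ((z - p) \<bullet> b)) + \<eta>\<^sup>2 * \<sigma>\<^sup>2 * (b \<bullet> b)"
      unfolding power2_norm_eq_inner
      by (simp only: inner_diff_left inner_diff_right inner_scaleR_left inner_scaleR_right
            inner_commute power2_eq_square) (simp add: algebra_simps inner_commute)
    finally show ?thesis
      using b(1) \<open>\<sigma> * _ = _\<close> \<open>\<sigma>\<^sup>2 = 1\<close> by (simp add: dist_norm)
  qed
  moreover have "2 * \<eta> * dist z p / DIM('a) \<le> 2 * \<eta> * \<bar>(z - p) \<bullet> b\<bar>"
  proof -
    have "2 * \<eta> * (norm (z - p) / DIM('a)) \<le> 2 * \<eta> * \<bar>(z - p) \<bullet> b\<bar>"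
      using b(2) assms by (intro mult_left_mono) auto
    then show ?thesis by (simp add: dist_norm)
  qed
  ultimately show ?thesis by (intro bexI[of _ "p + (\<eta> * \<sigma>) *\<^sub>R b"]) auto
qed

section \<open>Distributing crosses over the parameter interval\<close>

text \<open>The radius from \<open>touching_ball_dist_near\<close> depends on \<open>t\<close>, so
  the partition comes from the Bolzano bisection principle: \<open>P\<close> holds on short
  intervals around each \<open>t\<close> by one cross, and passes to adjacent intervals by attaching
  successively.\<close>

lemma attach_crosses:
  fixes \<gamma> :: "real \<Rightarrow> 'a::euclidean_space"
  assumes "a < b" and lip: "C-lipschitz_on {a..b} \<gamma>" and "0 < s" "0 < \<epsilon>"
  shows "\<exists>\<Gamma>'. lipschitz_curve \<Gamma>' \<and> \<gamma> ` {a..b} \<subseteq> \<Gamma>' \<and>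
           hausdorff1 \<Gamma>' \<le> hausdorff1 (\<gamma> ` {a..b}) + ennreal \<epsilon> \<and>
           (\<forall>u\<in>{a..b}. \<forall>z. dist z (\<gamma> u) = s \<and> (\<forall>v\<in>{a..b}. s \<le> dist z (\<gamma> v)) \<longrightarrow>
              (\<exists>y\<in>\<Gamma>'. dist z y < s))"
proof -
  define n where "n = real DIM('a)"
  have n: "n > 0" by (simp add: n_def)
  \<comment> \<open>A cross has at most \<open>2 * n\<close> arms, each \<theta> times the length of
    its interval, so all crosses together cost at most \<epsilon>.\<close>
  define \<theta> where "\<theta> = \<epsilon> / (2 * n * (b - a))"
  have \<theta>: "\<theta> > 0" "2 * n * \<theta> * (b - a) = \<epsilon>" using assms n by (simp_all add: \<theta>_def)
  define touch where "touch u z \<longleftrightarrow> dist z (\<gamma> u) = s \<and> (\<forall>v\<in>{a..b}. s \<le> dist z (\<gamma> v))" for u z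
  \<comment> \<open>The starting curve is arbitrary so that the curve built on one interval can be
    fed to the next. The guard \<open>c < d\<close> excludes single points, whose budget of length 0
    leaves no room for a cross. The intersection with \<open>{a..b}\<close> allows for intervals
    that stick out of the domain.\<close>
  define P where "P c d \<longleftrightarrow> c < d \<longrightarrow> (\<forall>\<Gamma>. lipschitz_curve \<Gamma> \<and> \<gamma> ` {a..b} \<subseteq> \<Gamma> \<longrightarrow>
      (\<exists>\<Gamma>'. lipschitz_curve \<Gamma>' \<and> \<Gamma> \<subseteq> \<Gamma>' \<and>
           hausdorff1 \<Gamma>' \<le> hausdorff1 \<Gamma> + ennreal (2 * n * \<theta> * (d - c)) \<and>
           (\<forall>u\<in>{a..b} \<inter> {c..d}. \<forall>z. touch u z \<longrightarrow> (\<exists>y\<in>\<Gamma>'. dist z y < s))))" for c d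
  have "P a b"
    using less_imp_le[OF \<open>a < b\<close>]
  proof (induction rule: Bolzano)
    case (trans c d e)
    consider "c = d" | "d = e" | "c < d" "d < e" using trans by linarith
    then show ?case
    proof cases
      case 3
      show ?thesis unfolding P_def
      proof (intro impI allI)
        fix \<Gamma> assume \<Gamma>: "lipschitz_curve \<Gamma> \<and> \<gamma> ` {a..b} \<subseteq> \<Gamma>"
        then obtain \<Gamma>1 where 1: "lipschitz_curve \<Gamma>1" "\<Gamma> \<subseteq> \<Gamma>1"
          "hausdorff1 \<Gamma>1 \<le> hausdorff1 \<Gamma> + ennreal (2 * n * \<theta> * (d - c))"
          "\<forall>u\<in>{a..b} \<inter> {c..d}. \<forall>z. touch u z \<longrightarrow> (\<exists>y\<in>\<Gamma>1. dist z y < s)"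
          using \<open>P c d\<close> 3 unfolding P_def by meson
        then have "lipschitz_curve \<Gamma>1 \<and> \<gamma> ` {a..b} \<subseteq> \<Gamma>1" using \<Gamma> by blast
        then obtain \<Gamma>2 where 2: "lipschitz_curve \<Gamma>2" "\<Gamma>1 \<subseteq> \<Gamma>2"
          "hausdorff1 \<Gamma>2 \<le> hausdorff1 \<Gamma>1 + ennreal (2 * n * \<theta> * (e - d))"
          "\<forall>u\<in>{a..b} \<inter> {d..e}. \<forall>z. touch u z \<longrightarrow> (\<exists>y\<in>\<Gamma>2. dist z y < s)"
          using \<open>P d e\<close> 3 unfolding P_def by meson
        have "hausdorff1 \<Gamma>2 \<le>
            (hausdorff1 \<Gamma> + ennreal (2 * n * \<theta> * (d - c))) + ennreal (2 * n * \<theta> * (e - d))"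
          using 2(3) add_right_mono[OF 1(3)] by (rule order_trans)
        also have "\<dots> = hausdorff1 \<Gamma> + ennreal (2 * n * \<theta> * (e - c))"
        proof -
          have "2 * n * \<theta> * (e - c) = 2 * n * \<theta> * (d - c) + 2 * n * \<theta> * (e - d)"
            by (simp add: algebra_simps)
          then show ?thesis using 3 n \<theta> by (simp add: ennreal_plus add.assoc)
        qed
        finally have "hausdorff1 \<Gamma>2 \<le> hausdorff1 \<Gamma> + ennreal (2 * n * \<theta> * (e - c))" .
        moreover have "\<exists>y\<in>\<Gamma>2. dist z y < s" if "u \<in> {a..b} \<inter> {c..e}" "touch u z" for u z
        proof (cases "u \<le> d")
          case True
          then have "u \<in> {a..b} \<inter> {c..d}" using that by auto
          then obtain y where "y \<in> \<Gamma>1" "dist z y < s" using 1(4) \<open>touch u z\<close> by blast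
          then show ?thesis using 2(2) by blast
        next
          case False
          then have "u \<in> {a..b} \<inter> {d..e}" using that by auto
          then show ?thesis using 2(4) \<open>touch u z\<close> by blast
        qed
        ultimately show "\<exists>\<Gamma>'. lipschitz_curve \<Gamma>' \<and> \<Gamma> \<subseteq> \<Gamma>' \<and>
             hausdorff1 \<Gamma>' \<le> hausdorff1 \<Gamma> + ennreal (2 * n * \<theta> * (e - c)) \<and>
             (\<forall>u\<in>{a..b} \<inter> {c..e}. \<forall>z. touch u z \<longrightarrow> (\<exists>y\<in>\<Gamma>'. dist z y < s))"
          using 1(2) 2(1,2) by (intro exI[of _ \<Gamma>2] conjI ballI allI impI) auto
      qed
    qed (use trans in auto)
  next
    case (local t)
    then have t: "t \<in> {a..b}" by simp
    \<comment> \<open>With this slope the excess of the squared distance over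
      \<open>s\<^sup>2\<close> is at most \<open>\<eta> * (s / n)\<close>, half of the gain
      \<open>2 * \<eta> * (s / n)\<close> offered by a cross of size
      \<open>\<eta> = \<theta> * (d - c)\<close>.\<close>
    have "0 < \<theta> * s / n" using \<theta> n \<open>0 < s\<close> by simp
    then obtain \<delta> where \<delta>: "\<delta> > 0" "\<forall>u\<in>{a..b}. \<forall>z. \<bar>u - t\<bar> < \<delta> \<and> touch u z \<longrightarrow>
        (dist z (\<gamma> t))\<^sup>2 \<le> s\<^sup>2 + \<theta> * s / n * \<bar>u - t\<bar>"
      using touching_ball_dist_near[OF lip t \<open>0 < s\<close>] unfolding touch_def by blast
    have small: "P c d" if cd: "c \<le> t" "t \<le> d" "d - c < min \<delta> (s / (n * \<theta>))" for c d
      unfolding P_def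
    proof (intro impI allI)
      assume "c < d"
      fix \<Gamma> assume \<Gamma>: "lipschitz_curve \<Gamma> \<and> \<gamma> ` {a..b} \<subseteq> \<Gamma>"
      define \<eta> where "\<eta> = \<theta> * (d - c)"
      have \<eta>: "0 < \<eta>" using \<open>c < d\<close> \<theta> by (simp add: \<eta>_def)
      \<comment> \<open>The second bound on \<open>d - c\<close> makes \<open>\<eta>\<^sup>2\<close>
        smaller than the remaining half of the gain.\<close>
      have "\<eta> < s / n" using cd(3) \<theta> n by (simp add: \<eta>_def field_simps)
      have "\<gamma> t \<in> \<Gamma>" using \<Gamma> t by blast
      have "\<exists>\<Gamma>'. lipschitz_curve \<Gamma>' \<and> \<Gamma> \<union> cross (\<gamma> t) \<eta> \<subseteq> \<Gamma>' \<and>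
          hausdorff1 \<Gamma>' \<le> hausdorff1 \<Gamma> + ennreal (card (cross (\<gamma> t) \<eta>) * \<eta>)"
        by (rule attach_star[OF finite_cross _ \<open>\<gamma> t \<in> \<Gamma>\<close>]) (use \<Gamma> \<eta> in \<open>simp_all add: dist_cross\<close>)
      then obtain \<Gamma>' where \<Gamma>': "lipschitz_curve \<Gamma>'" "\<Gamma> \<union> cross (\<gamma> t) \<eta> \<subseteq> \<Gamma>'"
        "hausdorff1 \<Gamma>' \<le> hausdorff1 \<Gamma> + ennreal (card (cross (\<gamma> t) \<eta>) * \<eta>)"
        by (elim exE conjE)
      have "real (card (cross (\<gamma> t) \<eta>)) \<le> 2 * n"
        using card_cross_le[of "\<gamma> t" \<eta>] unfolding n_def by linarith
      then have "card (cross (\<gamma> t) \<eta>) * \<eta> \<le> 2 * n * \<eta>"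
        using \<eta> by (intro mult_right_mono) auto
      then have "hausdorff1 \<Gamma> + ennreal (card (cross (\<gamma> t) \<eta>) * \<eta>) \<le> hausdorff1 \<Gamma> + ennreal (2 * n * \<eta>)"
        by (intro add_left_mono ennreal_leI)
      with \<Gamma>'(3) have "hausdorff1 \<Gamma>' \<le> hausdorff1 \<Gamma> + ennreal (2 * n * \<eta>)"
        by (rule order_trans)
      also have "2 * n * \<eta> = 2 * n * \<theta> * (d - c)" by (simp add: \<eta>_def)
      finally have "hausdorff1 \<Gamma>' \<le> hausdorff1 \<Gamma> + ennreal (2 * n * \<theta> * (d - c))" .
      moreover have "\<exists>y\<in>\<Gamma>'. dist z y < s" if u: "u \<in> {a..b} \<inter> {c..d}" "touch u z" for u z
      proof -
        have ut: "\<bar>u - t\<bar> \<le> d - c" using u cd by auto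
        then have "\<bar>u - t\<bar> < \<delta>" using cd by simp
        then have "(dist z (\<gamma> t))\<^sup>2 \<le> s\<^sup>2 + \<theta> * s / n * \<bar>u - t\<bar>" using \<delta>(2) u by blast
        also have "\<dots> \<le> s\<^sup>2 + \<theta> * s / n * (d - c)"
          using ut \<open>0 < \<theta> * s / n\<close> by (intro add_left_mono mult_left_mono) auto
        finally have zt: "(dist z (\<gamma> t))\<^sup>2 \<le> s\<^sup>2 + \<eta> * (s / n)" by (simp add: \<eta>_def ac_simps)
        obtain y where y: "y \<in> cross (\<gamma> t) \<eta>"
          "(dist z y)\<^sup>2 \<le> (dist z (\<gamma> t))\<^sup>2 - 2 * \<eta> * dist z (\<gamma> t) / n + \<eta>\<^sup>2"
          using ex_cross_dist_le[of \<eta> "\<gamma> t" z] \<eta> unfolding n_def by auto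
        \<comment> \<open>Since \<open>z\<close> touches the curve, its distance from
          \<open>\<gamma> t\<close> is at least \<open>s\<close>, which bounds the gain from
          below.\<close>
        have "2 * \<eta> * (s / n) \<le> 2 * \<eta> * dist z (\<gamma> t) / n"
          using u t n \<eta> by (auto simp: touch_def divide_right_mono mult_left_mono)
        moreover have "\<eta>\<^sup>2 < \<eta> * (s / n)"
          using \<eta> \<open>\<eta> < s / n\<close> unfolding power2_eq_square by (intro mult_strict_left_mono)
        ultimately have "(dist z y)\<^sup>2 < s\<^sup>2" using y(2) zt by linarith
        then have "dist z y < s" using \<open>0 < s\<close> by (simp add: power_less_imp_less_base)
        then show ?thesis using y \<Gamma>' by blast
      qed
      ultimately show "\<exists>\<Gamma>'. lipschitz_curve \<Gamma>' \<and> \<Gamma> \<subseteq> \<Gamma>' \<and>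
           hausdorff1 \<Gamma>' \<le> hausdorff1 \<Gamma> + ennreal (2 * n * \<theta> * (d - c)) \<and>
           (\<forall>u\<in>{a..b} \<inter> {c..d}. \<forall>z. touch u z \<longrightarrow> (\<exists>y\<in>\<Gamma>'. dist z y < s))"
        using \<Gamma>'(1,2) by (intro exI[of _ \<Gamma>'] conjI ballI allI impI) auto
    qed
    show ?case
    proof (intro exI conjI allI impI)
      show "0 < min \<delta> (s / (n * \<theta>))" using \<delta>(1) \<theta>(1) n \<open>0 < s\<close> by simp
    qed (elim conjE, rule small)
  qed
  note attach = this[unfolded P_def, rule_format, OF \<open>a < b\<close>]
  have "lipschitz_curve (\<gamma> ` {a..b}) \<and> \<gamma> ` {a..b} \<subseteq> \<gamma> ` {a..b}"
    unfolding lipschitz_curve_def lipschitz_parameterization_def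
    by (intro conjI exI[of _ a] exI[of _ b] exI[of _ \<gamma>] exI[of _ C] \<open>a < b\<close> lip refl order_refl)
  from attach[OF this] show ?thesis
    by (simp only: touch_def \<theta>(2) Int_absorb)
qed

section \<open>Compactness and the choice of the finite set\<close>

lemma compact_closed_nbhd:
  fixes A :: "'a::heine_borel set"
  assumes "bounded A"
  shows "compact (closed_nbhd A r)"
proof (cases "A = {}")
  case False
  have "closed {x. infdist x A \<le> r}" by (intro closed_Collect_le continuous_intros)
  moreover have "bounded {x. infdist x A \<le> r}"
  proof -
    obtain x0 R where R: "\<And>y. y \<in> A \<Longrightarrow> dist x0 y \<le> R"
      using assms unfolding bounded_def by blast
    have "dist x0 x \<le> R + (r + 1)" if "infdist x A \<le> r" for x
    proof -
      \<comment> \<open>The infimum may fail to be attained in \<open>A\<close>; the slack 1 yields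
        an actual point of \<open>A\<close>.\<close>
      have "infdist x A < r + 1" using that by simp
      then obtain y where "y \<in> A" "dist x y < r + 1"
        using False by (auto simp: infdist_def cINF_less_iff)
      then show ?thesis using R[of y] dist_triangle[of x0 x y] by (simp add: dist_commute)
    qed
    then show ?thesis unfolding bounded_def by blast
  qed
  ultimately show ?thesis using False by (simp add: closed_nbhd_def compact_eq_bounded_closed)
qed (simp add: closed_nbhd_def)

theorem lemma3p5:
  fixes \<Gamma> :: "(real^2) set" and s \<epsilon> :: real
  assumes "0 < s"
    and "lipschitz_curve \<Gamma>"
    and "has_positive_length \<Gamma>"
    and "0 < \<epsilon>"
  shows "\<exists>(X :: (real^2) set) (\<Gamma>' :: (real^2) set).
           finite X \<and> lipschitz_curve \<Gamma>' \<and> X \<subseteq> \<Gamma>' \<and>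
           closed_nbhd \<Gamma> s \<subseteq> closed_nbhd X s \<and>
           hausdorff1 \<Gamma> \<le> hausdorff1 \<Gamma>' \<and>
           hausdorff1 \<Gamma>' \<le> hausdorff1 \<Gamma> + ennreal \<epsilon>"
proof -
  obtain a b C and \<gamma> :: "real \<Rightarrow> real^2" where ab: "a < b" and lip: "C-lipschitz_on {a..b} \<gamma>" and \<Gamma>: "\<Gamma> = \<gamma> ` {a..b}"
    using assms(2) unfolding lipschitz_curve_def lipschitz_parameterization_def by metis
  have cpt: "compact \<Gamma>"
    unfolding \<Gamma> using lipschitz_on_continuous_on[OF lip] by (rule compact_continuous_image) simp
  have ne: "\<Gamma> \<noteq> {}" using ab \<Gamma> by auto
  obtain \<Gamma>' where \<Gamma>': "lipschitz_curve \<Gamma>'" "\<Gamma> \<subseteq> \<Gamma>'"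
    "hausdorff1 \<Gamma>' \<le> hausdorff1 \<Gamma> + ennreal \<epsilon>"
    "\<And>u z. u \<in> {a..b} \<Longrightarrow> dist z (\<gamma> u) = s \<Longrightarrow> \<forall>v\<in>{a..b}. s \<le> dist z (\<gamma> v) \<Longrightarrow> \<exists>y\<in>\<Gamma>'. dist z y < s"
    using attach_crosses[OF ab lip \<open>0 < s\<close> \<open>0 < \<epsilon>\<close>] unfolding \<Gamma> by blast
  \<comment> \<open>The strict inequality gained from the crosses turns the covering into one by
    open balls, to which compactness applies.\<close>
  have "closed_nbhd \<Gamma> s \<subseteq> (\<Union>y\<in>\<Gamma>'. ball y s)"
  proof
    fix z assume "z \<in> closed_nbhd \<Gamma> s"
    then have "infdist z \<Gamma> \<le> s" by (simp add: closed_nbhd_def)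
    obtain x where "x \<in> \<Gamma>" "infdist z \<Gamma> = dist z x"
      using infdist_attains_inf[OF compact_imp_closed[OF cpt] ne] .
    then obtain u where u: "u \<in> {a..b}" "infdist z \<Gamma> = dist z (\<gamma> u)"
      unfolding \<Gamma> by blast
    have "\<exists>y\<in>\<Gamma>'. dist z y < s"
    \<comment> \<open>At distance exactly \<open>s\<close> the nearest point
      \<open>\<gamma> u\<close> makes \<open>z\<close> a touching centre, which the crosses handle;
      at smaller distance \<open>\<gamma> u\<close> itself is close enough.\<close>
    proof (cases "infdist z \<Gamma> = s")
      case True
      then have "\<forall>v\<in>{a..b}. s \<le> dist z (\<gamma> v)" using infdist_le[of _ \<Gamma> z] \<Gamma> by blast
      then show ?thesis using \<Gamma>'(4)[of u z] u True by simp
    next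
      case False
      then have "dist z (\<gamma> u) < s" using u(2) \<open>infdist z \<Gamma> \<le> s\<close> by simp
      moreover have "\<gamma> u \<in> \<Gamma>'" using u(1) \<Gamma> \<Gamma>'(2) by blast
      ultimately show ?thesis by blast
    qed
    then show "z \<in> (\<Union>y\<in>\<Gamma>'. ball y s)" by (auto simp: dist_commute)
  qed
  \<comment> \<open>The centres of a finite subcover form \<open>X\<close>; they lie on
    \<open>\<Gamma>'\<close> because the balls were indexed by its points.\<close>
  from compactE_image[OF compact_closed_nbhd[OF compact_imp_bounded[OF cpt]] open_ball this]
  obtain X where X: "X \<subseteq> \<Gamma>'" "finite X" "closed_nbhd \<Gamma> s \<subseteq> (\<Union>y\<in>X. ball y s)" .
  have "closed_nbhd \<Gamma> s \<subseteq> closed_nbhd X s"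
  proof
    fix z assume "z \<in> closed_nbhd \<Gamma> s"
    then obtain y where "y \<in> X" "dist z y < s" using X(3) by (auto simp: dist_commute)
    then show "z \<in> closed_nbhd X s"
      using infdist_le[OF \<open>y \<in> X\<close>, of z] by (auto simp: closed_nbhd_def)
  qed
  then show ?thesis using X(1,2) \<Gamma>'(1,3) hausdorff1_mono[OF \<Gamma>'(2)] by blast
qed

end
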